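(* Suppose $\succsim$ is represented by $U(p)=\sum_{i=1}^n\mathrm{CE}(f[p_{A_i}],v^{A_i})$ for some partition $\{A_i\}_{i=1}^n$ of $I$ and indices $v^{A_1},\dots,v^{A_n}$. Then $\succsim$ satisfies dominance if and only if it is represented by $U(p)=\mathbb E^{f[p]}\,v$ for some $v$.
   Context: $N>1$ is an integer, $I=\{1,\dots,N\}$, $b>0$, $Z=[-b,b]$, $X=Z^N$, and for $A\subseteq I$, $X_A=Z^A$. $\Delta(Y)$ is the set of finitely supported probability measures on $Y$; $p_A$ is the marginal of $p\in\Delta(X)$ on the coordinates in $A$. $\succsim$ is a binary relation on $\Delta(X)$ with asymmetric part $\succ$ and symmetric part $\sim$; it is represented by $U$ if $p\succsim q\iff U(p)\geqslant U(q)$ for all $p,q\in\Delta(X)$. For $p\in\Delta(X_A)$, $f[p]$ is the distribution of the total $\sum_{i\in A}x_i$ when $x\sim p$. For a distribution $g$ with finite support in the domain of a continuous strictly increasing function $v$, $\mathbb E^g v$ is the expectation of $v$ under $g$ and $\mathrm{CE}(g,v)=v^{-1}(\mathbb E^g v)$ is the certainty equivalent. Each $v^{A_i}$ is a continuous, strictly increasing, twice continuously differentiable real function on $[-|A_i|b,|A_i|b]$; the index $v$ in the conclusion is likewise a continuous, strictly increasing function, defined on $[-Nb,Nb]$. For finitely supported distributions $g,h$ on $\mathbb R$, $g\succ_{FOSD}h$ means $g\ne h$ and $\sum_{x\leqslant z}h(x)\geqslant\sum_{x\leqslant z}g(x)$ for all $z$. $\succsim$ satisfies dominance if for all $p,q\in\Delta(X)$: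 $f[p]=f[q]$ implies $p\sim q$, and $f[p]\succ_{FOSD}f[q]$ implies $p\succ q$. *)

theory Defs
  imports "HOL-Probability.Probability" "HOL-Library.Disjoint_Sets"
begin

definition profiles :: "real \<Rightarrow> nat set \<Rightarrow> (nat \<Rightarrow> real) set" where
  "profiles b A = A \<rightarrow>\<^sub>E {-b..b}"

definition lotteries :: "'a set \<Rightarrow> 'a pmf set" where
  "lotteries Y = {p. finite (set_pmf p) \<and> set_pmf p \<subseteq> Y}"

definition marginal :: "nat set \<Rightarrow> (nat \<Rightarrow> real) pmf \<Rightarrow> (nat \<Rightarrow> real) pmf" where
  "marginal A p = map_pmf (\<lambda>x. restrict x A) p"

definition total_dist :: "nat set \<Rightarrow> (nat \<Rightarrow> real) pmf \<Rightarrow> real pmf" where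
  "total_dist A p = map_pmf (\<lambda>x. \<Sum>i\<in>A. x i) p"

definition total_range :: "real \<Rightarrow> nat set \<Rightarrow> real set" where
  "total_range b A = {-(real (card A) * b)..real (card A) * b}"

definition is_index :: "real set \<Rightarrow> (real \<Rightarrow> real) \<Rightarrow> bool" where
  "is_index S v \<longleftrightarrow> continuous_on S v \<and> strict_mono_on S v"

text \<open>Derivatives are taken within \<open>S\<close>, hence are one-sided at the endpoints of a closed interval;
  the values of \<open>v\<close> outside \<open>S\<close> play no role.\<close>

definition C2_on :: "real set \<Rightarrow> (real \<Rightarrow> real) \<Rightarrow> bool" where
  "C2_on S v \<longleftrightarrow> (\<exists>v' v''.
     (\<forall>x\<in>S. (v has_real_derivative v' x) (at x within S)) \<and>
     (\<forall>x\<in>S. (v' has_real_derivative v'' x) (at x within S)) \<and>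
     continuous_on S v'')"

definition certainty_equiv :: "real set \<Rightarrow> real pmf \<Rightarrow> (real \<Rightarrow> real) \<Rightarrow> real" where
  "certainty_equiv S g v = inv_into S v (measure_pmf.expectation g v)"

definition strict_part :: "('a \<Rightarrow> 'a \<Rightarrow> bool) \<Rightarrow> 'a \<Rightarrow> 'a \<Rightarrow> bool" where
  "strict_part R p q \<longleftrightarrow> R p q \<and> \<not> R q p"

definition sym_part :: "('a \<Rightarrow> 'a \<Rightarrow> bool) \<Rightarrow> 'a \<Rightarrow> 'a \<Rightarrow> bool" where
  "sym_part R p q \<longleftrightarrow> R p q \<and> R q p"

definition represented_on :: "'a set \<Rightarrow> ('a \<Rightarrow> 'a \<Rightarrow> bool) \<Rightarrow> ('a \<Rightarrow> real) \<Rightarrow> bool" where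
  "represented_on D R U \<longleftrightarrow> (\<forall>p\<in>D. \<forall>q\<in>D. R p q \<longleftrightarrow> U p \<ge> U q)"

definition fosd :: "real pmf \<Rightarrow> real pmf \<Rightarrow> bool" where
  "fosd g h \<longleftrightarrow> g \<noteq> h \<and>
     (\<forall>z. (\<Sum>x | x \<in> set_pmf h \<and> x \<le> z. pmf h x) \<ge> (\<Sum>x | x \<in> set_pmf g \<and> x \<le> z. pmf g x))"

definition dominance ::
  "nat \<Rightarrow> real \<Rightarrow> ((nat \<Rightarrow> real) pmf \<Rightarrow> (nat \<Rightarrow> real) pmf \<Rightarrow> bool) \<Rightarrow> bool" where
  "dominance N b R \<longleftrightarrow>
     (\<forall>p \<in> lotteries (profiles b {1..N}). \<forall>q \<in> lotteries (profiles b {1..N}).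
        (total_dist {1..N} p = total_dist {1..N} q \<longrightarrow> sym_part R p q) \<and>
        (fosd (total_dist {1..N} p) (total_dist {1..N} q) \<longrightarrow> strict_part R p q))"

end

theory Submission
  imports Defs
begin

text \<open>Strict dominance raises the expectation of every increasing index, by Abel summation; this gives one
  direction. For the other, a single block makes the representation a monotone transform of expected
  utility. With two blocks or more, shifting a risk \<open>\<plusminus>h\<close> from one block to another leaves the
  distribution of the total unchanged, so the risk premia of the two blocks at \<open>h\<close> agree; but opposite
  risks \<open>\<plusminus>h\<close> and \<open>\<mp>h\<close> on the two blocks cancel in the total, so these premia add up to zero. Hence all
  premia for small risks vanish, the derivative of each index is locally constant, each index is affine,
  and the representation is the expected total.\<close>

section \<open>Expectations and stochastic dominance\<close>

lemma expectation_finite_superset: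
  fixes w :: "'a \<Rightarrow> real"
  assumes "finite T" "set_pmf g \<subseteq> T"
  shows "measure_pmf.expectation g w = (\<Sum>x\<in>T. pmf g x * w x)"
  using assms by (subst integral_measure_pmf[of T]) (auto simp: mult.commute)

text \<open>The bound \<open>C\<close> plays the role of the value of \<open>w\<close> at a point above \<open>T\<close>, which makes the
  induction on the largest element go through.\<close>

lemma sum_mult_gt_if_partial_sums_nonpos:
  fixes d w :: "'a::linorder \<Rightarrow> real"
  assumes "finite T" "strict_mono_on T w" "\<forall>x\<in>T. w x < C"
    and "\<forall>z\<in>T. (\<Sum>x | x \<in> T \<and> x \<le> z. d x) \<le> 0" "\<exists>x\<in>T. d x \<noteq> 0"
  shows "C * sum d T < (\<Sum>x\<in>T. d x * w x)"
  using assms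
proof (induction T arbitrary: C rule: finite_linorder_max_induct)
  case empty
  then show ?case by simp
next
  case (insert b T)
  have b: "b \<notin> T" using insert.hyps by auto
  have "{x. x \<in> insert b T \<and> x \<le> b} = insert b T" using insert.hyps by force
  with insert.prems(3) have le0: "sum d (insert b T) \<le> 0" by (metis insertI1)
  have wb: "w b < C" using insert.prems by auto
  show ?case
  \<comment> \<open>If \<open>d\<close> is nonzero below \<open>b\<close>, the induction hypothesis
    with bound \<open>w b\<close> supplies strictness; raising the bound to \<open>C\<close> only
    lowers the left side, since the total of \<open>d\<close> is nonpositive. Otherwise
    \<open>d b\<close> alone is the total, hence negative, and strictness comes from
    \<open>w b < C\<close>.\<close>
  proof (cases "\<exists>x\<in>T. d x \<noteq> 0")
    case True
    have "(\<Sum>x | x \<in> T \<and> x \<le> z. d x) \<le> 0" if z: "z \<in> T" for z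
    proof -
      have "{x. x \<in> insert b T \<and> x \<le> z} = {x. x \<in> T \<and> x \<le> z}"
        using insert.hyps z by force
      with insert.prems(3) z show ?thesis by (metis insertI2)
    qed
    moreover have "strict_mono_on T w" "\<forall>x\<in>T. w x < w b"
      using insert.prems(1) insert.hyps(2) by (auto simp: strict_mono_on_def)
    ultimately have "w b * sum d T < (\<Sum>x\<in>T. d x * w x)"
      using insert.IH True by blast
    moreover have "C * sum d (insert b T) \<le> w b * sum d (insert b T)"
      using wb le0 by (intro mult_right_mono_neg) auto
    ultimately show ?thesis using insert.hyps b by (simp add: algebra_simps)
  next
    case False
    then have "sum d T = 0" "(\<Sum>x\<in>T. d x * w x) = 0" "d b \<noteq> 0"
      using insert.prems(4) by auto
    then show ?thesis using le0 wb insert.hyps b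
      by (simp add: mult.commute[of C] mult_less_cancel_left)
  qed
qed

text \<open>The difference \<open>d\<close> of the two mass functions has nonpositive partial sums
  and total zero. The preceding inequality therefore has left side zero, and its right side is the
  difference of the expectations.\<close>

lemma fosd_expectation_less:
  fixes w :: "real \<Rightarrow> real"
  assumes "fosd g h" "finite (set_pmf g)" "finite (set_pmf h)"
    and "set_pmf g \<subseteq> S" "set_pmf h \<subseteq> S" "strict_mono_on S w"
  shows "measure_pmf.expectation h w < measure_pmf.expectation g w"
proof -
  define T where "T = set_pmf g \<union> set_pmf h"
  define d where "d = (\<lambda>x. pmf g x - pmf h x)"
  have T: "finite T" "T \<subseteq> S" using assms by (auto simp: T_def)
  have cum: "(\<Sum>x | x \<in> set_pmf k \<and> x \<le> z. pmf k x) = (\<Sum>x | x \<in> T \<and> x \<le> z. pmf k x)"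
    if "k = g \<or> k = h" for k z
  proof (intro sum.mono_neutral_left)
    show "finite {x. x \<in> T \<and> x \<le> z}" using T(1) by simp
  qed (use that in \<open>auto simp: T_def set_pmf_iff\<close>)
  have "\<forall>z\<in>T. (\<Sum>x | x \<in> T \<and> x \<le> z. d x) \<le> 0"
    using assms(1) by (auto simp: fosd_def cum d_def sum_subtractf)
  moreover obtain x where x: "pmf g x \<noteq> pmf h x"
    using assms(1) by (auto simp: fosd_def pmf_eq_iff)
  then have "\<exists>x\<in>T. d x \<noteq> 0"
    by (intro bexI[of _ x]) (auto simp: d_def T_def set_pmf_iff)
  moreover have "strict_mono_on T w"
    using assms(6) T(2) by (auto simp: strict_mono_on_def)
  \<comment> \<open>Any strict upper bound of \<open>w\<close> on \<open>T\<close> would do, because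
    it gets multiplied by \<open>sum d T = 0\<close>.\<close>
  moreover have "\<forall>x\<in>T. w x < Max (w ` T) + 1"
  proof
    fix y assume "y \<in> T"
    then have "w y \<le> Max (w ` T)" using T(1) by simp
    then show "w y < Max (w ` T) + 1" by simp
  qed
  ultimately have "(Max (w ` T) + 1) * sum d T < (\<Sum>x\<in>T. d x * w x)"
    by (intro sum_mult_gt_if_partial_sums_nonpos T)
  moreover have "sum d T = 0"
    using T by (simp add: d_def sum_subtractf sum_pmf_eq_1 T_def)
  moreover have "(\<Sum>x\<in>T. d x * w x) = measure_pmf.expectation g w - measure_pmf.expectation h w"
    using T(1) by (simp add: d_def left_diff_distrib sum_subtractf
        expectation_finite_superset[of T] T_def)
  ultimately show ?thesis by simp
qed

section \<open>Certainty equivalents\<close>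

text \<open>The expectation lies between \<open>v a\<close> and \<open>v c\<close>, so by the
  intermediate value theorem it is attained on the interval; hence \<open>inv_into\<close> returns a
  genuine preimage and not an arbitrary value.\<close>

lemma certainty_equiv_props:
  fixes a c :: real
  assumes "is_index {a..c} v" "finite (set_pmf g)" "set_pmf g \<subseteq> {a..c}"
  shows "certainty_equiv {a..c} g v \<in> {a..c}"
    and "v (certainty_equiv {a..c} g v) = measure_pmf.expectation g v"
proof -
  have mono: "v x \<le> v y" if "x \<in> {a..c}" "y \<in> {a..c}" "x \<le> y" for x y
    using assms(1) that unfolding is_index_def strict_mono_on_def
    by (metis less_eq_real_def)
  have ac: "a \<le> c" using assms(3) set_pmf_not_empty[of g] by fastforce
  have int: "integrable (measure_pmf g) v" using assms(2) by (rule integrable_measure_pmf_finite)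
  have "v a \<le> measure_pmf.expectation g v"
    by (intro measure_pmf.integral_ge_const[OF int])
       (use assms(3) ac mono in \<open>auto intro!: AE_pmfI simp: subset_iff\<close>)
  moreover have "measure_pmf.expectation g v \<le> v c"
    by (intro measure_pmf.integral_le_const[OF int])
       (use assms(3) ac mono in \<open>auto intro!: AE_pmfI simp: subset_iff\<close>)
  ultimately obtain x where "x \<in> {a..c}" "v x = measure_pmf.expectation g v"
    using IVT'[of v a _ c] ac assms(1) unfolding is_index_def by auto
  then have *: "measure_pmf.expectation g v \<in> v ` {a..c}" by (metis imageI)
  show "certainty_equiv {a..c} g v \<in> {a..c}"
    unfolding certainty_equiv_def by (rule inv_into_into[OF *])
  show "v (certainty_equiv {a..c} g v) = measure_pmf.expectation g v"
    unfolding certainty_equiv_def by (rule f_inv_into_f[OF *])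
qed

lemma certainty_equiv_eqI:
  fixes a c :: real
  assumes "is_index {a..c} v" "x \<in> {a..c}" "measure_pmf.expectation g v = v x"
  shows "certainty_equiv {a..c} g v = x"
  unfolding certainty_equiv_def assms(3)
  using assms by (intro inv_into_f_f) (auto simp: is_index_def strict_mono_on_imp_inj_on)

lemma certainty_equiv_return:
  fixes a c :: real
  assumes "is_index {a..c} v" "x \<in> {a..c}"
  shows "certainty_equiv {a..c} (return_pmf x) v = x"
  using assms by (intro certainty_equiv_eqI) auto

lemma certainty_equiv_affine:
  fixes a c :: real
  assumes "is_index {a..c} v" "finite (set_pmf g)" "set_pmf g \<subseteq> {a..c}"
    and "\<And>x. x \<in> {a..c} \<Longrightarrow> v x = r + m * x" "m \<noteq> 0"
  shows "certainty_equiv {a..c} g v = measure_pmf.expectation g (\<lambda>x. x)"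
proof -
  have "measure_pmf.expectation g v = measure_pmf.expectation g (\<lambda>x. r + m * x)"
    using assms(3,4) by (intro integral_cong_AE) (auto intro!: AE_pmfI)
  also have "\<dots> = r + m * measure_pmf.expectation g (\<lambda>x. x)"
    using assms(2) by (subst Bochner_Integration.integral_add)
      (auto intro: integrable_measure_pmf_finite)
  finally show ?thesis
    using certainty_equiv_props[OF assms(1-3)] assms(4,5) by simp
qed

text \<open>Differentiating the midpoint identity in \<open>h\<close> gives v'(x + h) = v'(x - h).
  The derivative thus agrees at interior points less than 2\<delta> apart, and connectedness makes
  it constant.\<close>

lemma affine_if_locally_midpoint_affine:
  fixes v :: "real \<Rightarrow> real"
  assumes "a < c" "\<delta> > 0"
    and deriv: "\<And>x. x \<in> {a..c} \<Longrightarrow> (v has_real_derivative v' x) (at x within {a..c})"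
    and mid: "\<And>x h. 0 \<le> h \<Longrightarrow> h \<le> \<delta> \<Longrightarrow> a \<le> x - h \<Longrightarrow> x + h \<le> c \<Longrightarrow> v (x + h) + v (x - h) = 2 * v x"
  obtains r m where "\<And>x. x \<in> {a..c} \<Longrightarrow> v x = r + m * x"
proof -
  have deriv_at: "(v has_real_derivative v' x) (at x)" if "x \<in> {a<..<c}" for x
    using deriv[of x] that by (simp add: at_within_Icc_at)
  have near: "v' y = v' z" if "y \<in> {a<..<c}" "z \<in> {a<..<c}" "y < z" "z - y < 2 * \<delta>" for y z
  proof -
    define x h where "x = (y + z) / 2" and "h = (z - y) / 2"
    have xh: "x + h = z" "x - h = y" "0 < h" "h < \<delta>"
      using that by (auto simp: x_def h_def field_simps)
    have "((\<lambda>t. v (x + t) + v (x - t)) has_real_derivative v' z * 1 + v' y * (-1)) (at h)"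
      using deriv_at that xh
      by (intro DERIV_add DERIV_chain2[where f = v]) (auto intro!: derivative_eq_intros)
    \<comment> \<open>The midpoint identity holds for all \<open>t\<close> in an open interval
      around \<open>h\<close>, so there the function equals the constant
      \<open>2 * v x\<close>.\<close>
    moreover have "((\<lambda>t. v (x + t) + v (x - t)) has_real_derivative 0) (at h)"
    proof (rule has_field_derivative_transform_within_open[where f = "\<lambda>t. 2 * v x"
          and S = "{0<..<min \<delta> (min (x - a) (c - x))}"])
      show "h \<in> {0<..<min \<delta> (min (x - a) (c - x))}" using that xh by auto
    qed (auto simp: mid)
    ultimately show ?thesis using DERIV_unique by fastforce
  qed
  define x0 where "x0 = (a + c) / 2"
  have x0: "x0 \<in> {a<..<c}" using assms(1) by (auto simp: x0_def)
  have const: "v' x = v' x0" if x: "x \<in> {a<..<c}" for x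
  proof (rule connected_local_const[where f = v' and A = "{a<..<c}"])
    show "\<forall>y\<in>{a<..<c}. eventually (\<lambda>z. v' y = v' z) (at y within {a<..<c})"
    proof
      fix y assume y: "y \<in> {a<..<c}"
      show "eventually (\<lambda>z. v' y = v' z) (at y within {a<..<c})"
        unfolding eventually_at
      proof (intro exI[of _ "2 * \<delta>"] conjI ballI impI)
        fix z assume "z \<in> {a<..<c}" "z \<noteq> y \<and> dist z y < 2 * \<delta>"
        then show "v' y = v' z"
          using near[of y z] near[of z y] y by (cases "y < z") (auto simp: dist_real_def)
      qed (use assms in auto)
    qed
  qed (use x x0 in auto)
  \<comment> \<open>Subtracting the line of slope \<open>v' x0\<close> leaves interior derivative
    zero; continuity on the closed interval carries constancy to the endpoints.\<close>
  have "v x - v' x0 * x = v a - v' x0 * a" if x: "x \<in> {a..c}" for x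
  proof (cases "x = a")
    case False
    then have ax: "a < x" using x by auto
    have "continuous_on {a..c} v" using deriv by (rule DERIV_continuous_on)
    then have "continuous_on {a..x} (\<lambda>x. v x - v' x0 * x)"
      using x by (intro continuous_intros) (auto elim: continuous_on_subset)
    moreover have "((\<lambda>x. v x - v' x0 * x) has_real_derivative 0) (at y)" if "a < y" "y < x" for y
      using deriv_at[of y] const[of y] that x by (auto intro!: derivative_eq_intros)
    ultimately show ?thesis using DERIV_isconst_end[OF ax] by blast
  qed simp
  then have "v x = (v a - v' x0 * a) + v' x0 * x" if "x \<in> {a..c}" for x
    using that by (simp add: algebra_simps)
  then show thesis by (rule that)
qed

section \<open>Lotteries over profiles\<close>

lemma total_dist_marginal: "total_dist B (marginal B p) = total_dist B p"
  by (simp add: total_dist_def marginal_def pmf.map_comp o_def cong: sum.cong)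

lemma sum_profile_in_total_range:
  assumes "x \<in> profiles b C" "B \<subseteq> C" "b \<ge> 0"
  shows "sum x B \<in> total_range b B"
proof -
  have x: "x i \<in> {-b..b}" if "i \<in> B" for i
    using assms that unfolding profiles_def by (metis PiE_mem subsetD)
  have "sum x B \<le> real (card B) * b" using x by (intro sum_bounded_above) auto
  moreover have "real (card B) * (- b) \<le> sum x B" using x by (intro sum_bounded_below) auto
  ultimately show ?thesis by (simp add: total_range_def)
qed

lemma total_dist_lottery:
  assumes "p \<in> lotteries (profiles b C)" "B \<subseteq> C" "b \<ge> 0"
  shows "finite (set_pmf (total_dist B p))" "set_pmf (total_dist B p) \<subseteq> total_range b B"
  using assms sum_profile_in_total_range[of _ b C B]
  by (auto simp: lotteries_def total_dist_def subset_iff)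

lemma dominance_if_expected_utility:
  assumes w: "is_index (total_range b {1..N}) w" and "b \<ge> 0"
    and rep: "represented_on (lotteries (profiles b {1..N})) R
      (\<lambda>p. measure_pmf.expectation (total_dist {1..N} p) w)"
  shows "dominance N b R"
  unfolding dominance_def
proof (intro ballI conjI impI)
  fix p q assume pq: "p \<in> lotteries (profiles b {1..N})" "q \<in> lotteries (profiles b {1..N})"
  show "sym_part R p q" if "total_dist {1..N} p = total_dist {1..N} q"
    using rep pq that by (auto simp: sym_part_def represented_on_def)
  show "strict_part R p q" if "fosd (total_dist {1..N} p) (total_dist {1..N} q)"
  proof -
    have "measure_pmf.expectation (total_dist {1..N} q) w
        < measure_pmf.expectation (total_dist {1..N} p) w"
      using w total_dist_lottery[OF pq(1) order_refl assms(2)]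
        total_dist_lottery[OF pq(2) order_refl assms(2)]
      unfolding is_index_def by (intro fosd_expectation_less[OF that]) blast+
    then show ?thesis
      using rep pq by (auto simp: strict_part_def represented_on_def)
  qed
qed

section \<open>Several blocks\<close>

text \<open>Injectivity of \<open>A\<close> makes distinct indices name disjoint blocks, so the sum
  over indices counts each block once.\<close>

locale block_representation =
  fixes N n :: nat and b :: real
    and R :: "(nat \<Rightarrow> real) pmf \<Rightarrow> (nat \<Rightarrow> real) pmf \<Rightarrow> bool"
    and A :: "nat \<Rightarrow> nat set" and v :: "nat set \<Rightarrow> real \<Rightarrow> real"
  assumes b: "b > 0"
    and part: "partition_on {1..N} (A ` {1..n})" and inj: "inj_on A {1..n}"
    and index: "\<And>i. i \<in> {1..n} \<Longrightarrow> is_index (total_range b (A i)) (v (A i))"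
    and rep: "represented_on (lotteries (profiles b {1..N})) R
           (\<lambda>p. \<Sum>i=1..n. certainty_equiv (total_range b (A i))
                             (total_dist (A i) (marginal (A i) p)) (v (A i)))"
begin

abbreviation CE :: "nat \<Rightarrow> real pmf \<Rightarrow> real" where
  "CE i g \<equiv> certainty_equiv (total_range b (A i)) g (v (A i))"

lemma block_subset: "i \<in> {1..n} \<Longrightarrow> A i \<subseteq> {1..N}"
  using part by (auto simp: partition_on_def)

lemma block_finite: "i \<in> {1..n} \<Longrightarrow> finite (A i)"
  using block_subset finite_subset by blast

lemma block_card:
  assumes "i \<in> {1..n}"
  shows "card (A i) \<ge> 1"
proof -
  have "A i \<noteq> {}" using part assms unfolding partition_on_def by (metis imageI)
  then show ?thesis using block_finite[OF assms] by (simp add: Suc_le_eq card_gt_0_iff)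
qed

lemma block_disjoint:
  assumes "i \<in> {1..n}" "j \<in> {1..n}" "i \<noteq> j"
  shows "A i \<inter> A j = {}"
proof -
  have "A i \<noteq> A j" using inj assms by (metis inj_onD)
  then show ?thesis using part assms unfolding partition_on_def disjoint_def by blast
qed

lemma block_Union: "(\<Union>i\<in>{1..n}. A i) = {1..N}"
  using part by (simp add: partition_on_def)

lemma le_range: "i \<in> {1..n} \<Longrightarrow> b \<le> real (card (A i)) * b"
  using block_card[of i] b by simp

text \<open>Blocks are nonempty; this lets the one step size \<open>b\<close> serve all of
  them.\<close>

lemma small_in_range: "i \<in> {1..n} \<Longrightarrow> \<bar>x\<bar> \<le> b \<Longrightarrow> x \<in> total_range b (A i)"
  using le_range[of i] by (auto simp: total_range_def abs_le_iff)

lemma CE_return: "i \<in> {1..n} \<Longrightarrow> x \<in> total_range b (A i) \<Longrightarrow> CE i (return_pmf x) = x"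
  using index[of i] certainty_equiv_return unfolding total_range_def by blast

lemma single_block_expected_utility:
  assumes "n = 1"
  shows "is_index (total_range b {1..N}) (v {1..N}) \<and>
    represented_on (lotteries (profiles b {1..N})) R
      (\<lambda>p. measure_pmf.expectation (total_dist {1..N} p) (v {1..N}))"
proof -
  have A1: "A 1 = {1..N}" using block_Union assms by simp
  have ix: "is_index (total_range b {1..N}) (v {1..N})" using index[of 1] A1 assms by simp
  have "CE 1 (total_dist {1..N} q) \<le> CE 1 (total_dist {1..N} p) \<longleftrightarrow>
      measure_pmf.expectation (total_dist {1..N} q) (v {1..N})
        \<le> measure_pmf.expectation (total_dist {1..N} p) (v {1..N})"
    if "p \<in> lotteries (profiles b {1..N})" "q \<in> lotteries (profiles b {1..N})" for p q
  proof -
    have props: "certainty_equiv (total_range b {1..N}) (total_dist {1..N} p) (v {1..N})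
          \<in> total_range b {1..N}"
        "v {1..N} (certainty_equiv (total_range b {1..N}) (total_dist {1..N} p) (v {1..N}))
          = measure_pmf.expectation (total_dist {1..N} p) (v {1..N})"
      if "p \<in> lotteries (profiles b {1..N})" for p
      using certainty_equiv_props[OF ix[unfolded total_range_def]]
        total_dist_lottery[OF that order_refl less_imp_le[OF b]]
      unfolding total_range_def by blast+
    have "strict_mono_on (total_range b {1..N}) (v {1..N})" using ix by (simp add: is_index_def)
    \<comment> \<open>Applying the increasing index to both certainty equivalents preserves their
      order and turns them into expectations.\<close>
    from strict_mono_on_less_eq[OF this props(1)[OF that(2)] props(1)[OF that(1)]]
    show ?thesis
      unfolding A1 props(2)[OF that(1)] props(2)[OF that(2)] by (rule sym)
  qed
  then show ?thesis
    using rep ix assms by (simp add: represented_on_def total_dist_marginal A1[unfolded One_nat_def])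
qed

text \<open>A common random source \<open>B\<close> drives the totals of two blocks while all other
  blocks stay at zero. The grand totals agree outcome by outcome, so dominance forces indifference,
  and only the two active blocks contribute to the representation.\<close>

lemma CE_sum_cong:
  assumes "dominance N b R"
    and ij: "i \<in> {1..n}" "j \<in> {1..n}" "i \<noteq> j" and fin: "finite (set_pmf B)"
    and s: "\<And>c. s c \<in> total_range b (A i)" "\<And>c. s' c \<in> total_range b (A i)"
    and t: "\<And>c. t c \<in> total_range b (A j)" "\<And>c. t' c \<in> total_range b (A j)"
    and eq: "\<And>c. s c + t c = s' c + t' c"
  shows "CE i (map_pmf s B) + CE j (map_pmf t B) = CE i (map_pmf s' B) + CE j (map_pmf t' B)"
proof -
  \<comment> \<open>Each prescribed block total is spread evenly over its block, which keeps every
    coordinate in [-b, b] whenever the total is in range.\<close>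
  define prof where "prof = (\<lambda>x y. \<lambda>k\<in>{1..N}. if k \<in> A i then x / real (card (A i))
    else if k \<in> A j then y / real (card (A j)) else 0)"
  define lot where "lot = (\<lambda>s t. map_pmf (\<lambda>c. prof (s c) (t c)) B)"
  have disj: "A i \<inter> A j = {}" using block_disjoint ij by blast
  have pos: "real (card (A i)) \<ge> 1" "real (card (A j)) \<ge> 1" using block_card ij by auto
  have sums: "sum (prof x y) (A i) = x" "sum (prof x y) (A j) = y"
    "\<And>k. k \<in> {1..n} \<Longrightarrow> k \<noteq> i \<Longrightarrow> k \<noteq> j \<Longrightarrow> sum (prof x y) (A k) = 0" for x y
  proof -
    have "sum (prof x y) (A i) = (\<Sum>k\<in>A i. x / real (card (A i)))"
      using block_subset[OF ij(1)] by (intro sum.cong) (auto simp: prof_def)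
    then show "sum (prof x y) (A i) = x" using pos by simp
    have "sum (prof x y) (A j) = (\<Sum>k\<in>A j. y / real (card (A j)))"
      using block_subset[OF ij(2)] disj by (intro sum.cong) (auto simp: prof_def)
    then show "sum (prof x y) (A j) = y" using pos by simp
    fix k assume k: "k \<in> {1..n}" "k \<noteq> i" "k \<noteq> j"
    then have "A k \<inter> A i = {}" "A k \<inter> A j = {}" using block_disjoint ij by auto
    then show "sum (prof x y) (A k) = 0"
      using block_subset[OF k(1)] by (intro sum.neutral) (auto simp: prof_def)
  qed
  have split: "(\<Sum>k=1..n. f k) = f i + f j" if "\<And>k. k \<in> {1..n} \<Longrightarrow> k \<noteq> i \<Longrightarrow> k \<noteq> j \<Longrightarrow> f k = 0"
    for f :: "nat \<Rightarrow> real"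
  proof -
    have "(\<Sum>k=1..n. f k) = (\<Sum>k\<in>{i, j}. f k)"
      using ij that by (intro sum.mono_neutral_right) auto
    then show ?thesis using ij by simp
  qed
  have total: "sum (prof x y) {1..N} = x + y" for x y
  proof -
    have "sum (prof x y) {1..N} = (\<Sum>k=1..n. sum (prof x y) (A k))"
      unfolding block_Union[symmetric]
      using block_finite block_disjoint by (intro sum.UNION_disjoint) auto
    then show ?thesis using split[of "\<lambda>k. sum (prof x y) (A k)"] sums by simp
  qed
  have val: "(\<Sum>k=1..n. CE k (total_dist (A k) (marginal (A k) (lot s t))))
      = CE i (map_pmf s B) + CE j (map_pmf t B)" for s t
  proof -
    \<comment> \<open>An inactive block has the sure total 0, whose certainty equivalent is 0 for
      every index.\<close>
    have "CE k (total_dist (A k) (lot s t)) = 0" if "k \<in> {1..n}" "k \<noteq> i" "k \<noteq> j" for k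
    proof -
      have "total_dist (A k) (lot s t) = return_pmf 0"
        using sums(3)[OF that] by (simp add: total_dist_def lot_def pmf.map_comp o_def)
      then show ?thesis using CE_return[OF that(1)] small_in_range[OF that(1), of 0] b by simp
    qed
    moreover have "total_dist (A i) (lot s t) = map_pmf s B" "total_dist (A j) (lot s t) = map_pmf t B"
      using sums by (simp_all add: total_dist_def lot_def pmf.map_comp o_def)
    ultimately show ?thesis
      unfolding total_dist_marginal by (subst split) simp_all
  qed
  have mem: "lot s t \<in> lotteries (profiles b {1..N})"
    if "\<And>c. s c \<in> total_range b (A i)" "\<And>c. t c \<in> total_range b (A j)" for s t
  proof -
    have "prof x y \<in> profiles b {1..N}"
      if "x \<in> total_range b (A i)" "y \<in> total_range b (A j)" for x y
    proof -
      have "x / real (card (A i)) \<in> {-b..b}" "y / real (card (A j)) \<in> {-b..b}"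
        using that pos by (auto simp: total_range_def field_simps)
      then show ?thesis using b by (auto simp: prof_def profiles_def)
    qed
    then show ?thesis using that fin by (auto simp: lotteries_def lot_def)
  qed
  have "total_dist {1..N} (lot s t) = total_dist {1..N} (lot s' t')"
    by (simp add: total_dist_def lot_def pmf.map_comp o_def total eq del: One_nat_def)
  then have "sym_part R (lot s t) (lot s' t')"
    using assms(1) mem[of s t] mem[of s' t'] s t unfolding dominance_def by blast
  then show ?thesis
    using rep mem[of s t] mem[of s' t'] s t val
    by (auto simp: sym_part_def represented_on_def intro: antisym)
qed

text \<open>Let c be the certainty equivalent on block \<open>j\<close> of a fair gamble between
  \<open>h\<close> and \<open>-h\<close>. Cancelling the two risks gives CE_i = x - c, moving the
  risk from \<open>i\<close> to \<open>j\<close> gives CE_i = x + c; hence c = 0 and CE_i =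
  x.\<close>

lemma index_midpoint:
  assumes "dominance N b R" and ij: "i \<in> {1..n}" "j \<in> {1..n}" "i \<noteq> j"
    and h: "0 \<le> h" "h \<le> b" and x: "x + h \<in> total_range b (A i)" "x - h \<in> total_range b (A i)"
  shows "v (A i) (x + h) + v (A i) (x - h) = 2 * v (A i) x"
proof -
  let ?B = "bernoulli_pmf (1 / 2)"
  let ?e = "\<lambda>c. if c then h else - h"
  have x0: "x \<in> total_range b (A i)" using x h by (auto simp: total_range_def)
  have j: "h \<in> total_range b (A j)" "- h \<in> total_range b (A j)" "0 \<in> total_range b (A j)"
    using h by (auto intro!: small_in_range ij)
  have const: "map_pmf (\<lambda>_. y) ?B = return_pmf y" for y :: real
    by (rule map_pmf_const)
  \<comment> \<open>Opposite risks driven by the same coin: the total is surely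
    \<open>x\<close>.\<close>
  have "CE i (map_pmf (\<lambda>c. x + ?e c) ?B) + CE j (map_pmf (\<lambda>c. - ?e c) ?B)
      = CE i (map_pmf (\<lambda>_. x) ?B) + CE j (map_pmf (\<lambda>_. 0) ?B)"
    using x x0 j by (intro CE_sum_cong assms) auto
  \<comment> \<open>The same risk, borne by block \<open>i\<close> or by block
    \<open>j\<close>.\<close>
  moreover have "CE i (map_pmf (\<lambda>c. x + ?e c) ?B) + CE j (map_pmf (\<lambda>_. 0) ?B)
      = CE i (map_pmf (\<lambda>_. x) ?B) + CE j (map_pmf ?e ?B)"
    using x x0 j by (intro CE_sum_cong assms) auto
  \<comment> \<open>The coin is fair, so the sign of the gamble does not affect its expected
    utility.\<close>
  moreover have "CE j (map_pmf (\<lambda>c. - ?e c) ?B) = CE j (map_pmf ?e ?B)"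
    by (simp add: certainty_equiv_def add.commute)
  ultimately have "CE i (map_pmf (\<lambda>c. x + ?e c) ?B) = x"
    using CE_return[OF ij(1) x0] CE_return[OF ij(2) j(3)] by (simp only: const)
  moreover have "v (A i) (CE i (map_pmf (\<lambda>c. x + ?e c) ?B))
      = measure_pmf.expectation (map_pmf (\<lambda>c. x + ?e c) ?B) (v (A i))"
    unfolding total_range_def
    using index[OF ij(1)] x by (intro certainty_equiv_props(2)) (auto simp: total_range_def)
  ultimately show ?thesis by simp
qed

lemma CE_eq_expectation:
  assumes "dominance N b R" "n > 1" and i: "i \<in> {1..n}"
    and C2: "C2_on (total_range b (A i)) (v (A i))"
    and p: "p \<in> lotteries (profiles b {1..N})"
  shows "CE i (total_dist (A i) p) = measure_pmf.expectation p (\<lambda>x. sum x (A i))"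
proof -
  define a where "a = real (card (A i)) * b"
  have range: "total_range b (A i) = {-a..a}" by (simp add: total_range_def a_def)
  have a: "a > 0" using le_range[OF i] b by (simp add: a_def)
  \<comment> \<open>Any other block can serve as the partner that absorbs the risk.\<close>
  obtain j where j: "j \<in> {1..n}" "i \<noteq> j"
  proof (cases "i = 1")
    case True then show thesis using that[of 2] assms(2) by simp
  next
    case False then show thesis using that[of 1] assms(2) by simp
  qed
  obtain v' where v': "\<And>x. x \<in> {-a..a} \<Longrightarrow> (v (A i) has_real_derivative v' x) (at x within {-a..a})"
    using C2 unfolding C2_on_def range by blast
  have "v (A i) (x + h) + v (A i) (x - h) = 2 * v (A i) x"
    if "0 \<le> h" "h \<le> b" "- a \<le> x - h" "x + h \<le> a" for x h
    using that by (intro index_midpoint[OF assms(1) i j]) (auto simp: range)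
  then obtain r m where rm: "\<And>x. x \<in> {-a..a} \<Longrightarrow> v (A i) x = r + m * x"
    using affine_if_locally_midpoint_affine[OF _ b v'] a by (metis minus_less_iff neg_less_pos)
  \<comment> \<open>Strict monotonicity rules out slope zero, so the affine index is risk
    neutral.\<close>
  have "v (A i) 0 < v (A i) a"
    using index[OF i] a by (auto simp: is_index_def range strict_mono_on_def)
  then have "m \<noteq> 0" using rm[of 0] rm[of a] a by auto
  then have "CE i (total_dist (A i) p) = measure_pmf.expectation (total_dist (A i) p) (\<lambda>x. x)"
    unfolding range
    using index[OF i] total_dist_lottery[OF p block_subset[OF i]] b rm
    by (intro certainty_equiv_affine) (auto simp: range)
  then show ?thesis by (simp add: total_dist_def)
qed

text \<open>Each block contributes its expected total, and by linearity these add up to the expected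
  grand total.\<close>

lemma several_blocks_expected_utility:
  assumes "dominance N b R" "n > 1"
    and C2: "\<And>i. i \<in> {1..n} \<Longrightarrow> C2_on (total_range b (A i)) (v (A i))"
  shows "represented_on (lotteries (profiles b {1..N})) R
    (\<lambda>p. measure_pmf.expectation (total_dist {1..N} p) (\<lambda>x. x))"
proof -
  have "(\<Sum>i=1..n. CE i (total_dist (A i) (marginal (A i) p)))
      = measure_pmf.expectation (total_dist {1..N} p) (\<lambda>x. x)"
    if p: "p \<in> lotteries (profiles b {1..N})" for p
  proof -
    have "(\<Sum>i=1..n. CE i (total_dist (A i) (marginal (A i) p)))
        = (\<Sum>i=1..n. measure_pmf.expectation p (\<lambda>x. sum x (A i)))"
      using CE_eq_expectation[OF assms(1,2) _ C2 p]
      by (intro sum.cong) (auto simp: total_dist_marginal)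
    also have "\<dots> = measure_pmf.expectation p (\<lambda>x. \<Sum>i=1..n. sum x (A i))"
      using p by (intro Bochner_Integration.integral_sum[symmetric] integrable_measure_pmf_finite)
        (auto simp: lotteries_def)
    also have "(\<lambda>x. \<Sum>i=1..n. sum x (A i)) = (\<lambda>x :: nat \<Rightarrow> real. sum x {1..N})"
      unfolding block_Union[symmetric]
      using block_finite block_disjoint by (intro ext sum.UNION_disjoint[symmetric]) auto
    finally show ?thesis by (simp add: total_dist_def)
  qed
  then show ?thesis using rep by (simp add: represented_on_def)
qed

end

theorem proposition1:
  fixes N n :: nat and b :: real
    and R :: "(nat \<Rightarrow> real) pmf \<Rightarrow> (nat \<Rightarrow> real) pmf \<Rightarrow> bool"
    and A :: "nat \<Rightarrow> nat set" and v :: "nat set \<Rightarrow> real \<Rightarrow> real"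
  assumes "N > 1" and "b > 0"
    and "partition_on {1..N} (A ` {1..n})" and "inj_on A {1..n}"
    and "\<And>i. i \<in> {1..n} \<Longrightarrow> is_index (total_range b (A i)) (v (A i))"
    and "\<And>i. i \<in> {1..n} \<Longrightarrow> C2_on (total_range b (A i)) (v (A i))"
    and "represented_on (lotteries (profiles b {1..N})) R
           (\<lambda>p. \<Sum>i=1..n. certainty_equiv (total_range b (A i))
                             (total_dist (A i) (marginal (A i) p)) (v (A i)))"
  shows "dominance N b R \<longleftrightarrow>
    (\<exists>w. is_index (total_range b {1..N}) w \<and>
         represented_on (lotteries (profiles b {1..N})) R
           (\<lambda>p. measure_pmf.expectation (total_dist {1..N} p) w))"
proof
  interpret block_representation N n b R A v
    using assms by unfold_locales
  assume dom: "dominance N b R"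
  \<comment> \<open>With no blocks the partition would cover nothing, although {1..N} is
    nonempty.\<close>
  have "n \<noteq> 0"
  proof
    assume "n = 0"
    then have "{1..N} = {}" using block_Union by simp
    then show False using assms(1) by simp
  qed
  then consider "n = 1" | "n > 1" by linarith
  then show "\<exists>w. is_index (total_range b {1..N}) w \<and>
         represented_on (lotteries (profiles b {1..N})) R
           (\<lambda>p. measure_pmf.expectation (total_dist {1..N} p) w)"
  proof cases
    case 1
    then show ?thesis using single_block_expected_utility by blast
  next
    case 2
    \<comment> \<open>The block indices are affine with possibly different slopes, but certainty
      equivalents do not see the slopes, so the identity is the common index.\<close>
    moreover have "is_index (total_range b {1..N}) (\<lambda>x. x)"
      by (auto simp: is_index_def strict_mono_on_def)
    ultimately show ?thesis using several_blocks_expected_utility[OF dom _ assms(6)] by blast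
  qed
next
  assume "\<exists>w. is_index (total_range b {1..N}) w \<and>
         represented_on (lotteries (profiles b {1..N})) R
           (\<lambda>p. measure_pmf.expectation (total_dist {1..N} p) w)"
  then show "dominance N b R"
    using dominance_if_expected_utility assms(2) less_imp_le by blast
qed

end
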